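(* Let $f$, $K$, $u,q,C,\kappa$, $\phi$, $(\xi_n)_{n\in\mathbb N}$, $\sigma$, $\lambda$ be as in the context, and let $\gamma\in(0,1)$. Let $\tau:\Omega\to\mathbb N_0$ be an a.s. finite random variable which is independent of the $\xi_i$, $i\in\mathbb N$. Then there exist positive constants $\varsigma,\eta,\delta$ such that for any solution $z_n$ of $$z_{n+1}=f(z_n)+\sigma\xi_{n+1}(z_n-K),\quad n\ge\tau,\qquad z_\tau\in(K-\delta,K+\delta),$$ the following hold. (i) There exists a set $\Omega_\gamma$ with $\mathbb P(\Omega_\gamma)>1-\gamma$ such that, on $\Omega_\gamma$, (a) $|z_m-K|\le\eta e^{-\varsigma(m-\tau)}$ for all $m\ge\tau$; (b) $z_m\to K$ as $m\to\infty$. (ii) There exist a set $\Omega_\gamma^{[1]}$ with $\mathbb P(\Omega_\gamma^{[1]})>1-\gamma$ and a nonrandom $n_0\in\mathbb N$ such that, on $\Omega_\gamma^{[1]}$, $$|z_m-K|\le\eta e^{-\varsigma(m-n_0)}\quad\text{for all } m\ge n_0 .$$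
   Context: $(\Omega,\mathcal F,(\mathcal F_n)_{n\in\mathbb N},\mathbb P)$ is a complete filtered probability space and $\mathbb N_0=\mathbb N\cup\{0\}$. Function $f$: $f:[0,\infty)\to[0,\infty)$ is continuous with a unique positive fixed point $K>0$, and $(z-K)(f(z)-K)<0$ for $z\ne K$. There are fixed positive constants $u,q,C,\kappa$ such that $f(z)=K-(1+q)(z-K)+\phi(z-K)$ whenever $z\in(K-u,K+u)$, where $|\phi(x)|\le C|x|^{1+\kappa}$ for all $x\in(-u,u)$. Noise: $(\xi_n)_{n\in\mathbb N}$ are mutually independent, identically distributed random variables with $|\xi_n|\le1$. The noise intensity is a constant $\sigma>0$, and there exists $\lambda>0$ such that $\mathbf E\ln|1+q-\sigma\xi_n|=-\lambda<0$. A solution is a sequence of random variables satisfying the recursion (it is required only as long as $z_n$ stays in the domain $[0,\infty)$ of $f$). *)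

theory Defs
  imports "HOL-Probability.Probability"
begin

text \<open>
  Time indices of the filtration and of the noise start at 1; the values at index 0 are
  irrelevant. Completeness of the filtration means that every \<open>F n\<close> contains the null sets.
\<close>

definition complete_filtered_prob_space :: "'a measure \<Rightarrow> (nat \<Rightarrow> 'a measure) \<Rightarrow> bool" where
  "complete_filtered_prob_space M F \<longleftrightarrow>
     prob_space M \<and> complete_measure M \<and>
     filtration (space M) (\<lambda>n. F (Suc n)) \<and>
     (\<forall>n\<ge>1. subalgebra M (F n) \<and> null_sets M \<subseteq> sets (F n))"

text \<open>
  Independence of a single random variable from a whole family: the two generated sigma-algebras
  are independent. The library constant \<open>indep_var\<close> would need equal value types.
\<close>

definition indep_of_family ::
  "'a measure \<Rightarrow> 'b measure \<Rightarrow> ('a \<Rightarrow> 'b) \<Rightarrow> 'c measure \<Rightarrow> ('i \<Rightarrow> 'a \<Rightarrow> 'c) \<Rightarrow> 'i set \<Rightarrow> bool" where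
  "indep_of_family M N X L Y I \<longleftrightarrow>
     prob_space.indep_set M
       (sets (vimage_algebra (space M) X N))
       (sets (vimage_algebra (space M) (\<lambda>\<omega>. \<lambda>i\<in>I. Y i \<omega>) (\<Pi>\<^sub>M i\<in>I. L)))"

text \<open>
  A sequence solves the recursion from time \<open>\<tau>\<close> on if, almost surely, the recursion holds at
  every step up to which the sequence has not left the domain \<open>[0, \<infinity>)\<close> of \<open>f\<close>.
  Nothing but measurability is required before \<open>\<tau>\<close> or after leaving the domain.
\<close>

definition is_solution ::
  "'a measure \<Rightarrow> (real \<Rightarrow> real) \<Rightarrow> real \<Rightarrow> real \<Rightarrow> (nat \<Rightarrow> 'a \<Rightarrow> real) \<Rightarrow> ('a \<Rightarrow> enat) \<Rightarrow>
    (nat \<Rightarrow> 'a \<Rightarrow> real) \<Rightarrow> bool" where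
  "is_solution M f K \<sigma> \<xi> \<tau> z \<longleftrightarrow>
     (\<forall>n. z n \<in> borel_measurable M) \<and>
     (AE \<omega> in M. \<forall>n. \<tau> \<omega> \<le> enat n \<longrightarrow>
        (\<forall>k\<le>n. \<tau> \<omega> \<le> enat k \<longrightarrow> 0 \<le> z k \<omega>) \<longrightarrow>
        z (Suc n) \<omega> = f (z n \<omega>) + \<sigma> * \<xi> (Suc n) \<omega> * (z n \<omega> - K))"

end

theory Submission
  imports Defs "HOL-Real_Asymp.Real_Asymp"
begin

text \<open>
  Near \<open>K\<close> the deviation \<open>x = z - K\<close> is multiplied in one step by at most
  \<open>\<bar>1 + q - \<sigma> \<xi>\<bar> + C \<bar>x\<bar>\<^sup>\<kappa> \<le> \<bar>1 + q - \<sigma> \<xi>\<bar> + \<epsilon>\<close>. By dominated convergence the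
  logarithm of the right-hand side still has negative mean for small \<open>\<epsilon>\<close>, and unlike
  \<open>ln \<bar>1 + q - \<sigma> \<xi>\<bar>\<close> it is bounded, so Hoeffding's inequality and a union bound control all
  partial sums by \<open>R - c n\<close> with high probability, uniformly in the starting time. Starting
  within \<open>\<delta> = r exp (- R)\<close> then keeps the solution forever in the \<open>r\<close>-neighbourhood of \<open>K\<close> where
  the one-step bound is valid. Independence transfers this to the random time \<open>\<tau>\<close>, restricted to
  \<open>\<tau> \<le> n0\<close>, so that one event serves for both parts.
\<close>


text \<open>By Hoeffding's inequality a block of \<open>n\<close> terms reaches half its negative
  mean with probability at most \<open>\<rho> ^ n\<close>, a bound that depends on the length of the
  block and not on its start \<open>k\<close>. A union bound over long blocks and the crude bound
  \<open>h\<close> per term on short ones give one \<open>R\<close> for all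
  \<open>k\<close>.\<close>

lemma (in prob_space) shifted_partial_sums_bounded:
  fixes X :: "nat \<Rightarrow> 'a \<Rightarrow> real"
  assumes indep: "indep_vars (\<lambda>_. borel) X {1..}"
    and bnd: "\<And>i. i \<ge> 1 \<Longrightarrow> AE \<omega> in M. X i \<omega> \<in> {l..h}"
    and mean: "\<And>i. i \<ge> 1 \<Longrightarrow> expectation (X i) = - m"
    and "m > 0" "l < h" "p > 0"
  obtains R where
    "\<And>k. prob {\<omega> \<in> space M. \<forall>n. (\<Sum>i\<in>{k<..k+n}. X i \<omega>) \<le> R - m / 2 * real n} \<ge> 1 - p"
proof -
  have X_meas [measurable]: "random_variable borel (X i)" if "i \<ge> 1" for i
    using indep that by (auto simp: indep_vars_def)
  have S_meas [measurable]: "random_variable borel (\<lambda>\<omega>. \<Sum>i\<in>{k<..k+n}. X i \<omega>)" for k n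
    by (intro borel_measurable_sum X_meas) auto
  \<comment> \<open>Hoeffding's exponent for \<open>n\<close> terms, with deviation
    \<open>n * m / 2\<close> and total squared range \<open>n * (h - l)\<^sup>2\<close>, is
    \<open>n\<close> times the exponent used here.\<close>
  define \<rho> where "\<rho> = exp (- (m\<^sup>2 / (2 * (h - l)\<^sup>2)))"
  have \<rho>: "0 < \<rho>" "\<rho> < 1" using \<open>m > 0\<close> \<open>l < h\<close> by (auto simp: \<rho>_def)
  define B where "B k n = {\<omega> \<in> space M. (\<Sum>i\<in>{k<..k+n}. X i \<omega>) \<ge> - (m / 2 * real n)}" for k n
  have B_meas [measurable]: "B k n \<in> events" for k n
    unfolding B_def by measurable
  have B_le: "prob (B k n) \<le> \<rho> ^ n" if "n \<ge> 1" for k n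
  proof -
    interpret H: Hoeffding_ineq M "{k<..k+n}" X "\<lambda>_. l" "\<lambda>_. h"
        "\<Sum>i\<in>{k<..k+n}. expectation (X i)"
    proof unfold_locales
      show "indep_vars (\<lambda>_. borel) X {k<..k+n}"
        by (rule indep_vars_subset[OF indep]) auto
      show "AE \<omega> in M. X i \<omega> \<in> {l..h}" if "i \<in> {k<..k+n}" for i
        by (rule bnd) (use that in auto)
    qed simp
    have mu: "(\<Sum>i\<in>{k<..k+n}. expectation (X i)) = - (real n * m)"
      by (simp add: mean)
    have pos: "(\<Sum>i\<in>{k<..k+n}. (h - l)\<^sup>2) > 0" using that \<open>l < h\<close> by simp
    have "prob (B k n) \<le> exp (-2 * (real n * m / 2)\<^sup>2 / (\<Sum>i\<in>{k<..k+n}. (h - l)\<^sup>2))"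
    proof -
      have "B k n = {\<omega> \<in> space M. (\<Sum>i\<in>{k<..k+n}. X i \<omega>) \<ge>
          (\<Sum>i\<in>{k<..k+n}. expectation (X i)) + real n * m / 2}"
        unfolding B_def mu by (simp add: field_simps)
      then show ?thesis
        using H.Hoeffding_ineq_ge[OF _ pos, of "real n * m / 2"] \<open>m > 0\<close> by simp
    qed
    also have "-2 * (real n * m / 2)\<^sup>2 / (\<Sum>i\<in>{k<..k+n}. (h - l)\<^sup>2)
        = real n * (- (m\<^sup>2 / (2 * (h - l)\<^sup>2)))"
    proof -
      define D where "D = (h - l)\<^sup>2"
      have "D > 0" using \<open>l < h\<close> by (simp add: D_def)
      then show ?thesis
        unfolding D_def[symmetric] using that by (simp add: field_simps power2_eq_square)
    qed
    finally show ?thesis by (simp only: \<rho>_def exp_of_nat_mult)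
  qed
  \<comment> \<open>The quotient is the geometric tail from \<open>N\<close> on, so \<open>N\<close>
    marks where long blocks begin.\<close>
  have "(\<lambda>N. \<rho> ^ N / (1 - \<rho>)) \<longlonglongrightarrow> 0 / (1 - \<rho>)"
    by (intro tendsto_intros LIMSEQ_power_zero) (use \<rho> in auto)
  then have "\<forall>\<^sub>F N in sequentially. \<rho> ^ N / (1 - \<rho>) < p"
    using \<open>p > 0\<close> by (auto dest: order_tendstoD(2))
  from eventually_happens'[OF sequentially_bot eventually_conj[OF eventually_ge_at_top[of 1] this]]
  obtain N where N: "N \<ge> 1" "\<rho> ^ N / (1 - \<rho>) < p"
    by blast
  \<comment> \<open>For \<open>n \<le> N\<close> the sum is at most \<open>N * \<bar>h\<bar>\<close>
    and \<open>N * m\<close> outweighs \<open>m / 2 * n\<close>; for \<open>n \<ge> N\<close> only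
    \<open>R \<ge> 0\<close> matters.\<close>
  define R where "R = real N * (\<bar>h\<bar> + m)"
  define G where
    "G k = {\<omega> \<in> space M. \<forall>n. (\<Sum>i\<in>{k<..k+n}. X i \<omega>) \<le> R - m / 2 * real n}" for k
  have [measurable]: "G k \<in> events" for k unfolding G_def by measurable
  have "prob (G k) \<ge> 1 - p" for k
  proof -
    have sm: "summable (\<lambda>n. \<rho> ^ (n + N))"
      using \<rho> by (simp add: power_add summable_mult2)
    have Ble': "prob (B k (n + N)) \<le> \<rho> ^ (n + N)" for n
      using B_le[of "n + N" k] N(1) by simp
    have smB: "summable (\<lambda>n. prob (B k (n + N)))"
      by (rule summable_comparison_test'[OF sm, of 0]) (use Ble' in auto)
    have "prob (\<Union>n. B k (n + N)) \<le> (\<Sum>n. prob (B k (n + N)))"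
      by (rule finite_measure_subadditive_countably[OF _ smB]) auto
    also have "\<dots> \<le> (\<Sum>n. \<rho> ^ (n + N))" by (rule suminf_le[OF Ble' smB sm])
    also have "\<dots> = \<rho> ^ N / (1 - \<rho>)"
      using \<rho> by (simp add: power_add suminf_mult2[symmetric] suminf_geometric field_simps)
    finally have U: "prob (\<Union>n. B k (n + N)) < p" using N by simp
    \<comment> \<open>The terms are bounded only almost surely, so the sets \<open>B\<close> cover
      the complement of \<open>G k\<close> only up to a null set.\<close>
    have "AE \<omega> in M. \<forall>i\<ge>1. X i \<omega> \<in> {l..h}"
      using bnd by (auto simp: AE_all_countable)
    then have "AE \<omega> in M. \<omega> \<in> space M - G k \<longrightarrow> \<omega> \<in> (\<Union>n. B k (n + N))"
    proof eventually_elim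
      case (elim \<omega>)
      show ?case
      proof
        assume w: "\<omega> \<in> space M - G k"
        then obtain n where n: "(\<Sum>i\<in>{k<..k+n}. X i \<omega>) > R - m / 2 * real n"
          by (auto simp: G_def not_le)
        have "n \<ge> N"
        proof (rule ccontr)
          assume "\<not> n \<ge> N"
          then have nN: "real n \<le> real N" by simp
          have "(\<Sum>i\<in>{k<..k+n}. X i \<omega>) \<le> (\<Sum>i\<in>{k<..k+n}. \<bar>h\<bar>)"
          proof (rule sum_mono)
            fix i assume "i \<in> {k<..k+n}"
            then have "X i \<omega> \<le> h" using elim by auto
            then show "X i \<omega> \<le> \<bar>h\<bar>" by simp
          qed
          also have "\<dots> = real n * \<bar>h\<bar>" by simp
          also have "\<dots> \<le> real N * \<bar>h\<bar>" using nN by (simp add: mult_right_mono)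
          finally have 1: "(\<Sum>i\<in>{k<..k+n}. X i \<omega>) \<le> real N * \<bar>h\<bar>" .
          have "m * real n \<le> m * real N" "0 \<le> m * real n"
            using nN \<open>m > 0\<close> by (auto intro: mult_left_mono)
          with 1 n show False by (simp add: R_def algebra_simps)
        qed
        moreover have "R \<ge> 0" using \<open>m > 0\<close> by (simp add: R_def)
        ultimately have "\<omega> \<in> B k ((n - N) + N)" using w n by (auto simp: B_def)
        then show "\<omega> \<in> (\<Union>n. B k (n + N))" by blast
      qed
    qed
    then have "prob (space M - G k) \<le> prob (\<Union>n. B k (n + N))"
      by (intro finite_measure_mono_AE) auto
    then show ?thesis using U prob_compl[of "G k"] by simp
  qed
  then show thesis unfolding G_def by (rule that)
qed

text \<open>The shifted logarithms lie between \<open>ln Z\<close> and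
  \<open>ln (\<bar>B\<bar> + 1)\<close>, so dominated convergence applies. Thus a negative mean of
  \<open>ln Z\<close> survives a small positive shift, which in turn makes the logarithm bounded
  below.\<close>

lemma (in prob_space) expectation_ln_add_tendsto:
  fixes Z :: "'a \<Rightarrow> real"
  assumes [measurable]: "random_variable borel Z"
    and pos: "AE \<omega> in M. 0 < Z \<omega>" and le: "AE \<omega> in M. Z \<omega> \<le> B"
    and int: "integrable M (\<lambda>\<omega>. ln (Z \<omega>))"
  shows "(\<lambda>n. expectation (\<lambda>\<omega>. ln (Z \<omega> + 1 / real (Suc n)))) \<longlonglongrightarrow> expectation (\<lambda>\<omega>. ln (Z \<omega>))"
proof (rule integral_dominated_convergence)
  show "integrable M (\<lambda>\<omega>. \<bar>ln (Z \<omega>)\<bar> + ln (\<bar>B\<bar> + 1))"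
    using int by auto
  show "AE \<omega> in M. (\<lambda>n. ln (Z \<omega> + 1 / real (Suc n))) \<longlonglongrightarrow> ln (Z \<omega>)"
    using pos
  proof eventually_elim
    case (elim \<omega>)
    have "(\<lambda>n. Z \<omega> + 1 / real (Suc n)) \<longlonglongrightarrow> Z \<omega> + 0"
      by (intro tendsto_intros LIMSEQ_Suc[OF lim_1_over_n])
    then show ?case using elim by (intro tendsto_ln) auto
  qed
  fix n
  show "AE \<omega> in M. norm (ln (Z \<omega> + 1 / real (Suc n))) \<le> \<bar>ln (Z \<omega>)\<bar> + ln (\<bar>B\<bar> + 1)"
    using pos le
  proof eventually_elim
    case (elim \<omega>)
    have e: "0 < 1 / real (Suc n)" "1 / real (Suc n) \<le> 1" by auto
    have "ln (Z \<omega>) \<le> ln (Z \<omega> + 1 / real (Suc n))"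
      using elim e by (subst ln_le_cancel_iff) linarith+
    moreover have "ln (Z \<omega> + 1 / real (Suc n)) \<le> ln (\<bar>B\<bar> + 1)"
      using elim e by (subst ln_le_cancel_iff) linarith+
    moreover have "0 \<le> ln (\<bar>B\<bar> + 1)" by simp
    ultimately show ?case unfolding real_norm_def by linarith
  qed
qed auto

text \<open>A continuation argument: while the path stays within \<open>r\<close>, the step factors
  multiply to the exponential of a partial sum of \<open>y\<close>, hence to at most
  \<open>exp R\<close>. Starting below \<open>d\<close> with \<open>d * exp R \<le> r\<close>, the
  next point is again within \<open>r\<close>.\<close>

lemma decay_from_log_sums:
  fixes x y :: "nat \<Rightarrow> real"
  assumes step: "\<And>n. k \<le> n \<Longrightarrow> (\<And>j. k \<le> j \<Longrightarrow> j \<le> n \<Longrightarrow> \<bar>x j\<bar> < r) \<Longrightarrow>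
      \<bar>x (Suc n)\<bar> \<le> \<bar>x n\<bar> * exp (y (Suc n))"
    and sums: "\<And>n. (\<Sum>i\<in>{k<..k+n}. y i) \<le> R - c * real n"
    and "\<bar>x k\<bar> < d" "d * exp R \<le> r" "c \<ge> 0"
  shows "\<bar>x (k + n)\<bar> \<le> d * exp R * exp (- c * real n)"
proof -
  have small: "\<bar>x k\<bar> * exp (\<Sum>i\<in>{k<..k+n}. y i) \<le> d * exp R * exp (- c * real n)" for n
  proof -
    have "exp (\<Sum>i\<in>{k<..k+n}. y i) \<le> exp R * exp (- c * real n)"
      using sums[of n] by (simp flip: exp_add)
    then have "\<bar>x k\<bar> * exp (\<Sum>i\<in>{k<..k+n}. y i) \<le> d * (exp R * exp (- c * real n))"
      using assms(3) by (intro mult_mono) auto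
    then show ?thesis by (simp add: mult.assoc)
  qed
  \<comment> \<open>The decay is dropped here; the strictness that \<open>step\<close> demands comes
    from \<open>\<bar>x k\<bar> < d\<close>.\<close>
  have smallr: "\<bar>x k\<bar> * exp (\<Sum>i\<in>{k<..k+n}. y i) < r" for n
  proof -
    have "c * real n \<ge> 0" using \<open>c \<ge> 0\<close> by simp
    then have "exp (\<Sum>i\<in>{k<..k+n}. y i) \<le> exp R"
      using sums[of n] by (subst exp_le_cancel_iff) linarith
    then have "\<bar>x k\<bar> * exp (\<Sum>i\<in>{k<..k+n}. y i) \<le> \<bar>x k\<bar> * exp R"
      by (intro mult_left_mono) auto
    also have "\<dots> < d * exp R" using assms(3) by simp
    finally show ?thesis using assms(4) by simp
  qed
  have "\<bar>x (k + n)\<bar> \<le> \<bar>x k\<bar> * exp (\<Sum>i\<in>{k<..k+n}. y i)" for n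
  \<comment> \<open>Strong induction, since \<open>step\<close> needs all points since
    \<open>k\<close> to be within \<open>r\<close>, not just the last one.\<close>
  proof (induction n rule: less_induct)
    case (less n)
    show ?case
    proof (cases n)
      case (Suc n')
      have "\<bar>x j\<bar> < r" if "k \<le> j" "j \<le> k + n'" for j
      proof -
        have "j - k < n" using that Suc by auto
        from le_less_trans[OF less.IH[OF this] smallr] show ?thesis using that by simp
      qed
      then have "\<bar>x (Suc (k + n'))\<bar> \<le> \<bar>x (k + n')\<bar> * exp (y (Suc (k + n')))"
        by (intro step) auto
      also have "\<dots> \<le> \<bar>x k\<bar> * exp (\<Sum>i\<in>{k<..k+n'}. y i) * exp (y (Suc (k + n')))"
        using less.IH[of n'] Suc by (intro mult_right_mono) auto
      also have "\<dots> = \<bar>x k\<bar> * exp (\<Sum>i\<in>insert (Suc (k + n')) {k<..k+n'}. y i)"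
        by (simp add: exp_add)
      also have "insert (Suc (k + n')) {k<..k+n'} = {k<..k+n}" using Suc by auto
      finally show ?thesis using Suc by simp
    qed simp
  qed
  with small show ?thesis by (meson order_trans)
qed

text \<open>By independence the disjoint pieces have total probability at least
  \<open>(1 - p)\<close> times that of \<open>\<tau> \<le> n0\<close>. This tends to
  \<open>1 - p > 1 - \<gamma>\<close> because \<open>\<tau>\<close> is almost surely finite.\<close>

lemma (in prob_space) event_at_independent_time:
  fixes \<tau> :: "'a \<Rightarrow> enat"
  assumes \<tau>_meas [measurable]: "\<tau> \<in> measurable M (count_space UNIV)"
    and fin: "AE \<omega> in M. \<tau> \<omega> < \<infinity>"
    and indep: "indep_set (sets (vimage_algebra (space M) \<tau> (count_space UNIV))) \<S>"
    and A: "\<And>k. A k \<in> \<S>" "\<And>k. prob (A k) \<ge> 1 - p"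
    and "p < \<gamma>"
  obtains n0 :: nat where "n0 \<ge> 1" "prob (\<Union>k\<le>n0. {\<omega> \<in> space M. \<tau> \<omega> = enat k} \<inter> A k) > 1 - \<gamma>"
proof -
  define T where "T k = {\<omega> \<in> space M. \<tau> \<omega> = enat k}" for k
  have T_meas [measurable]: "T k \<in> events" for k unfolding T_def by measurable
  have A_meas [measurable]: "A k \<in> events" for k
    using indep_setD_ev2[OF indep] A(1) by blast
  have prod: "prob (T k \<inter> A k) = prob (T k) * prob (A k)" for k
  proof (rule indep_setD[OF indep _ A(1)])
    have "T k = \<tau> -` {enat k} \<inter> space M" by (auto simp: T_def)
    then show "T k \<in> sets (vimage_algebra (space M) \<tau> (count_space UNIV))"
      by (simp add: in_vimage_algebra)
  qed
  have disj: "disjoint_family T" by (auto simp: disjoint_family_on_def T_def)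
  have "prob (\<Union>k. T k) = 1"
    by (rule prob_eq_1[THEN iffD2]) (use fin in \<open>auto simp: T_def\<close>)
  moreover have "(\<lambda>k. prob (T k)) sums prob (\<Union>k. T k)"
    by (rule finite_measure_UNION) (auto simp: disj)
  ultimately have "(\<lambda>n. \<Sum>k\<le>n. prob (T k)) \<longlonglongrightarrow> 1" by (simp add: sums_def_le)
  then have "(\<lambda>n. (1 - p) * (\<Sum>k\<le>n. prob (T k))) \<longlonglongrightarrow> (1 - p) * 1"
    by (intro tendsto_intros)
  then have "\<forall>\<^sub>F n in sequentially. (1 - p) * (\<Sum>k\<le>n. prob (T k)) > 1 - \<gamma>"
    using \<open>p < \<gamma>\<close> by (intro order_tendstoD(1)) auto
  from eventually_happens'[OF sequentially_bot eventually_conj[OF eventually_ge_at_top[of 1] this]]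
  obtain n0 where n0: "n0 \<ge> 1" "(1 - p) * (\<Sum>k\<le>n0. prob (T k)) > 1 - \<gamma>"
    by blast
  note n0(2)
  also have "(1 - p) * (\<Sum>k\<le>n0. prob (T k)) \<le> (\<Sum>k\<le>n0. prob (T k \<inter> A k))"
    unfolding sum_distrib_left prod
    by (intro sum_mono, subst mult.commute) (intro mult_left_mono A(2), simp)
  also have "\<dots> = prob (\<Union>k\<le>n0. T k \<inter> A k)"
    using disj by (intro finite_measure_finite_Union[symmetric])
      (auto simp: disjoint_family_on_def)
  finally show thesis using that n0(1) by (simp add: T_def)
qed

text \<open>The threshold on \<open>\<bar>v\<bar>\<close> is the point where
  \<open>C * \<bar>v\<bar> powr \<kappa>\<close> equals \<open>\<epsilon>\<close>; below it the
  remainder adds at most \<open>\<epsilon>\<close> to the linear factor.\<close>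

lemma perturbed_step_bound:
  fixes \<phi> :: "real \<Rightarrow> real"
  assumes "\<bar>\<phi> v\<bar> \<le> C * \<bar>v\<bar> powr (1 + \<kappa>)" "\<bar>v\<bar> \<le> (\<epsilon> / C) powr (1 / \<kappa>)"
    and "C > 0" "\<kappa> > 0" "\<epsilon> > 0"
  shows "\<bar>- a * v + \<phi> v\<bar> \<le> \<bar>v\<bar> * (\<bar>a\<bar> + \<epsilon>)"
proof -
  have "\<bar>v\<bar> powr \<kappa> \<le> ((\<epsilon> / C) powr (1 / \<kappa>)) powr \<kappa>"
    using assms by (intro powr_mono2) auto
  also have "\<dots> = \<epsilon> / C" using assms by (simp add: powr_powr)
  finally have "C * \<bar>v\<bar> powr \<kappa> \<le> \<epsilon>" using \<open>C > 0\<close> by (simp add: field_simps)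
  then have "\<bar>v\<bar> * (C * \<bar>v\<bar> powr \<kappa>) \<le> \<bar>v\<bar> * \<epsilon>" by (intro mult_left_mono) auto
  moreover have "\<bar>v\<bar> powr (1 + \<kappa>) = \<bar>v\<bar> * \<bar>v\<bar> powr \<kappa>"
    by (simp add: powr_add)
  ultimately have "\<bar>\<phi> v\<bar> \<le> \<bar>v\<bar> * \<epsilon>" using assms(1) by (simp add: mult.left_commute)
  then show ?thesis
    using abs_triangle_ineq[of "- a * v" "\<phi> v"] by (simp add: abs_mult algebra_simps)
qed

text \<open>\<open>\<tau>\<close> is \<open>enat\<close>-valued because it is finite only almost
  surely; \<open>the_enat\<close> is unspecified at infinity, which matters on a null set only.
  Stating the mean by \<open>has_bochner_integral\<close> includes integrability and rules out a
  default value of the integral.\<close>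

theorem theorem3p1:
  fixes M :: "'a measure" and F :: "nat \<Rightarrow> 'a measure"
    and f \<phi> :: "real \<Rightarrow> real" and K u q C \<kappa> \<sigma> lam \<gamma> :: real
    and \<xi> :: "nat \<Rightarrow> 'a \<Rightarrow> real" and \<tau> :: "'a \<Rightarrow> enat"
  assumes "complete_filtered_prob_space M F"
    and f_maps: "f ` {0..} \<subseteq> {0..}"
    and f_cont: "continuous_on {0..} f"
    and K_fix: "K > 0" "f K = K" "\<And>x. x > 0 \<Longrightarrow> f x = x \<Longrightarrow> x = K"
    and f_sign: "\<And>x. x \<ge> 0 \<Longrightarrow> x \<noteq> K \<Longrightarrow> (x - K) * (f x - K) < 0"
    and pos: "u > 0" "q > 0" "C > 0" "\<kappa> > 0"
    and f_expand: "\<And>x. x \<ge> 0 \<Longrightarrow> x \<in> {K - u<..<K + u} \<Longrightarrow>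
          f x = K - (1 + q) * (x - K) + \<phi> (x - K)"
    and phi_bound: "\<And>x. x \<in> {-u<..<u} \<Longrightarrow> \<bar>\<phi> x\<bar> \<le> C * \<bar>x\<bar> powr (1 + \<kappa>)"
    and xi_indep: "prob_space.indep_vars M (\<lambda>_. borel) \<xi> {1..}"
    and xi_ident: "\<And>n. n \<ge> 1 \<Longrightarrow> distr M borel (\<xi> n) = distr M borel (\<xi> 1)"
    and xi_bound: "\<And>n. n \<ge> 1 \<Longrightarrow> AE \<omega> in M. \<bar>\<xi> n \<omega>\<bar> \<le> 1"
    and sigma_pos: "\<sigma> > 0"
    and lam_pos: "lam > 0"
    and log_nz: "\<And>n. n \<ge> 1 \<Longrightarrow> AE \<omega> in M. 1 + q - \<sigma> * \<xi> n \<omega> \<noteq> 0"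
    and log_mean: "\<And>n. n \<ge> 1 \<Longrightarrow>
          has_bochner_integral M (\<lambda>\<omega>. ln \<bar>1 + q - \<sigma> * \<xi> n \<omega>\<bar>) (- lam)"
    and gamma: "0 < \<gamma>" "\<gamma> < 1"
    and tau_meas: "\<tau> \<in> measurable M (count_space UNIV)"
    and tau_finite: "AE \<omega> in M. \<tau> \<omega> < \<infinity>"
    and tau_indep: "indep_of_family M (count_space UNIV) \<tau> borel \<xi> {1..}"
  shows "\<exists>\<zeta>>0. \<exists>\<eta>>0. \<exists>\<delta>>0. \<forall>z :: nat \<Rightarrow> 'a \<Rightarrow> real.
     is_solution M f K \<sigma> \<xi> \<tau> z \<longrightarrow>
     (AE \<omega> in M. z (the_enat (\<tau> \<omega>)) \<omega> \<in> {K - \<delta><..<K + \<delta>}) \<longrightarrow>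
       (\<exists>\<Omega>\<^sub>\<gamma> \<in> sets M. measure M \<Omega>\<^sub>\<gamma> > 1 - \<gamma> \<and>
          (\<forall>\<omega>\<in>\<Omega>\<^sub>\<gamma>.
             (\<forall>m. \<tau> \<omega> \<le> enat m \<longrightarrow>
                \<bar>z m \<omega> - K\<bar> \<le> \<eta> * exp (- \<zeta> * (real m - real (the_enat (\<tau> \<omega>))))) \<and>
             (\<lambda>m. z m \<omega>) \<longlonglongrightarrow> K)) \<and>
       (\<exists>\<Omega>1 \<in> sets M. measure M \<Omega>1 > 1 - \<gamma> \<and>
          (\<exists>n0::nat. n0 \<ge> 1 \<and>
             (\<forall>\<omega>\<in>\<Omega>1. \<forall>m\<ge>n0.
                \<bar>z m \<omega> - K\<bar> \<le> \<eta> * exp (- \<zeta> * (real m - real n0)))))"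
proof -
  interpret prob_space M
    using assms(1) by (simp add: complete_filtered_prob_space_def)
  define a where "a = 1 + q"
  \<comment> \<open>For \<open>\<epsilon> > 0\<close>, \<open>exp (X \<epsilon> t)\<close> is
    exactly the factor of \<open>perturbed_step_bound\<close> for noise value
    \<open>t\<close>.\<close>
  define X where "X \<epsilon> t = ln (\<bar>a - \<sigma> * t\<bar> + \<epsilon>)" for \<epsilon> t :: real
  have X_meas [measurable]: "X \<epsilon> \<in> borel_measurable borel" for \<epsilon>
    unfolding X_def by measurable
  have xi_meas: "random_variable borel (\<xi> i)" if "i \<ge> 1" for i
    using xi_indep that by (auto simp: indep_vars_def)
  note xi_meas1 [measurable] = xi_meas[OF order_refl]
  have abs_le: "\<bar>a - \<sigma> * t\<bar> \<le> a + \<sigma>" if "\<bar>t\<bar> \<le> 1" for t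
  proof -
    have "\<bar>\<sigma> * t\<bar> \<le> \<sigma>" using that sigma_pos by (simp add: abs_mult mult_left_le)
    then show ?thesis using pos(2) unfolding a_def by linarith
  qed

  \<comment> \<open>Choice of a regularisation \<open>\<epsilon>\<close> that keeps the mean
    logarithm negative\<close>
  have "(\<lambda>n. expectation (\<lambda>\<omega>. ln (\<bar>a - \<sigma> * \<xi> 1 \<omega>\<bar> + 1 / real (Suc n))))
      \<longlonglongrightarrow> expectation (\<lambda>\<omega>. ln \<bar>a - \<sigma> * \<xi> 1 \<omega>\<bar>)"
  proof (rule expectation_ln_add_tendsto)
    \<comment> \<open>\<open>ln\<close> is total, so integrability of the logarithm alone does not
      exclude a vanishing factor; \<open>log_nz\<close> does.\<close>
    show "AE \<omega> in M. 0 < \<bar>a - \<sigma> * \<xi> 1 \<omega>\<bar>" using log_nz[of 1] by (simp add: a_def)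
    show "AE \<omega> in M. \<bar>a - \<sigma> * \<xi> 1 \<omega>\<bar> \<le> a + \<sigma>"
      using xi_bound[OF order_refl] by eventually_elim (rule abs_le)
    show "integrable M (\<lambda>\<omega>. ln \<bar>a - \<sigma> * \<xi> 1 \<omega>\<bar>)"
      using log_mean[of 1] by (simp add: a_def has_bochner_integral_iff)
  qed measurable
  moreover have "expectation (\<lambda>\<omega>. ln \<bar>a - \<sigma> * \<xi> 1 \<omega>\<bar>) = - lam"
    using log_mean[of 1] by (simp add: a_def has_bochner_integral_iff)
  ultimately have "\<forall>\<^sub>F n in sequentially.
      expectation (\<lambda>\<omega>. ln (\<bar>a - \<sigma> * \<xi> 1 \<omega>\<bar> + 1 / real (Suc n))) < 0"
    using lam_pos by (intro order_tendstoD(2)) auto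
  then obtain n where "expectation (\<lambda>\<omega>. ln (\<bar>a - \<sigma> * \<xi> 1 \<omega>\<bar> + 1 / real (Suc n))) < 0"
    by (auto simp: eventually_sequentially)
  then obtain \<epsilon> where eps: "\<epsilon> > 0" and neg: "expectation (\<lambda>\<omega>. X \<epsilon> (\<xi> 1 \<omega>)) < 0"
    by (auto simp: X_def intro!: that[of "1 / real (Suc n)"])

  \<comment> \<open>Uniform control of the partial sums of the regularised logarithms\<close>
  define m where "m = - expectation (\<lambda>\<omega>. X \<epsilon> (\<xi> 1 \<omega>))"
  have m: "m > 0" using neg by (simp add: m_def)
  \<comment> \<open>The level \<open>\<gamma> / 2\<close> leaves room for the later restriction to
    \<open>\<tau> \<le> n0\<close>.\<close>
  obtain R where R: "\<And>k. prob {\<omega> \<in> space M. \<forall>n.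
      (\<Sum>i\<in>{k<..k+n}. X \<epsilon> (\<xi> i \<omega>)) \<le> R - m / 2 * real n} \<ge> 1 - \<gamma> / 2"
  proof (rule shifted_partial_sums_bounded[where X = "\<lambda>i \<omega>. X \<epsilon> (\<xi> i \<omega>)"
        and l = "ln \<epsilon>" and h = "ln (a + \<sigma> + \<epsilon>)" and m = m and p = "\<gamma> / 2"])
    show "indep_vars (\<lambda>_. borel) (\<lambda>i \<omega>. X \<epsilon> (\<xi> i \<omega>)) {1..}"
      by (rule indep_vars_compose2[OF xi_indep]) simp
  next
    fix i :: nat assume i: "i \<ge> 1"
    show "AE \<omega> in M. X \<epsilon> (\<xi> i \<omega>) \<in> {ln \<epsilon>..ln (a + \<sigma> + \<epsilon>)}"
      using xi_bound[OF i]
    proof eventually_elim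
      case (elim \<omega>)
      have "ln \<epsilon> \<le> X \<epsilon> (\<xi> i \<omega>)"
        unfolding X_def using eps by (intro ln_mono) auto
      moreover have "X \<epsilon> (\<xi> i \<omega>) \<le> ln (a + \<sigma> + \<epsilon>)"
        unfolding X_def using eps abs_le[OF elim] by (intro ln_mono) auto
      ultimately show ?case by simp
    qed
    have "expectation (\<lambda>\<omega>. X \<epsilon> (\<xi> i \<omega>)) = (\<integral>t. X \<epsilon> t \<partial>distr M borel (\<xi> i))"
      by (rule integral_distr[symmetric]) (auto intro: xi_meas i)
    also have "\<dots> = (\<integral>t. X \<epsilon> t \<partial>distr M borel (\<xi> 1))" by (simp only: xi_ident[OF i])
    also have "\<dots> = expectation (\<lambda>\<omega>. X \<epsilon> (\<xi> 1 \<omega>))"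
      by (rule integral_distr) (rule xi_meas1 X_meas)+
    also have "\<dots> = - m" by (simp add: m_def)
    finally show "expectation (\<lambda>\<omega>. X \<epsilon> (\<xi> i \<omega>)) = - m" .
  next
    show "ln \<epsilon> < ln (a + \<sigma> + \<epsilon>)" using eps pos(2) sigma_pos by (simp add: a_def)
  qed (use m gamma in auto)

  \<comment> \<open>The good event at the random starting time\<close>
  define A where "A k = {\<omega> \<in> space M. \<forall>n.
      (\<Sum>i\<in>{k<..k+n}. X \<epsilon> (\<xi> i \<omega>)) \<le> R - m / 2 * real n}" for k
  let ?\<S> = "sets (vimage_algebra (space M) (\<lambda>\<omega>. \<lambda>i\<in>{1..}. \<xi> i \<omega>) (\<Pi>\<^sub>M i\<in>{1..}. borel))"
  have indep: "indep_set (sets (vimage_algebra (space M) \<tau> (count_space UNIV))) ?\<S>"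
    using tau_indep by (simp add: indep_of_family_def)
  \<comment> \<open>Independence of \<open>\<tau>\<close> concerns the sigma-algebra generated by
    the whole noise, so \<open>A k\<close> is written as a preimage under the noise sequence. Its
    indices start at \<open>k + 1 \<ge> 1\<close>, inside the index set
    \<open>{1..}\<close>.\<close>
  have A_in: "A k \<in> ?\<S>" for k
  proof -
    let ?P = "\<Pi>\<^sub>M i\<in>{1::nat..}. (borel :: real measure)"
    define D where "D = {x \<in> space ?P. \<forall>n.
        (\<Sum>i\<in>{k<..k+n}. X \<epsilon> (x i)) \<le> R - m / 2 * real n}"
    have [measurable]: "(\<lambda>x. \<Sum>i\<in>{k<..k+n}. X \<epsilon> (x i)) \<in> borel_measurable ?P" for n
      by (intro borel_measurable_sum measurable_compose[OF _ X_meas]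
          measurable_component_singleton) auto
    have "D \<in> sets ?P" unfolding D_def by measurable
    moreover have "A k = (\<lambda>\<omega>. \<lambda>i\<in>{1..}. \<xi> i \<omega>) -` D \<inter> space M"
      by (auto simp: A_def D_def space_PiM)
    ultimately show ?thesis by (simp add: in_vimage_algebra)
  qed
  have A_prob: "prob (A k) \<ge> 1 - \<gamma> / 2" for k using R unfolding A_def .
  obtain n0 :: nat where n0: "n0 \<ge> 1"
      "prob (\<Union>k\<le>n0. {\<omega> \<in> space M. \<tau> \<omega> = enat k} \<inter> A k) > 1 - \<gamma>"
    by (rule event_at_independent_time[where A = A, OF tau_meas tau_finite indep A_in A_prob])
      (use gamma in auto)
  define G where "G = (\<Union>k\<le>n0. {\<omega> \<in> space M. \<tau> \<omega> = enat k} \<inter> A k)"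
  have G_meas: "G \<in> events"
  proof -
    have "A k \<in> events" for k using indep_setD_ev2[OF indep] A_in by blast
    then show ?thesis unfolding G_def using tau_meas by (intro sets.finite_UN sets.Int) measurable
  qed

  \<comment> \<open>Within \<open>r\<close> of \<open>K\<close> the expansion of \<open>f\<close>
    holds (\<open>u\<close>), the solution stays in the domain of \<open>f\<close>
    (\<open>K\<close>), and the remainder is absorbed by \<open>\<epsilon>\<close> (last
    bound).\<close>
  define r where "r = min (min u K) ((\<epsilon> / C) powr (1 / \<kappa>))"
  define \<delta> where "\<delta> = r * exp (- R)"
  have r: "r > 0" using pos K_fix(1) eps by (simp add: r_def)
  have \<delta>: "\<delta> > 0" using r by (simp add: \<delta>_def)
  have \<delta>R: "\<delta> * exp R = r" by (simp add: \<delta>_def flip: exp_add)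
  show ?thesis
  \<comment> \<open>The rate is half of the mean drift, and \<open>\<eta> = r\<close> because
    \<open>\<delta> * exp R = r\<close>. These constants, like \<open>G\<close> and
    \<open>n0\<close>, are fixed before \<open>z\<close>.\<close>
  proof (rule exI[of _ "m / 2"], rule conjI[rotated], rule exI[of _ r], rule conjI[rotated],
      rule exI[of _ \<delta>], intro conjI allI impI)

    \<comment> \<open>Pathwise decay of a given solution\<close>
    fix z :: "nat \<Rightarrow> 'a \<Rightarrow> real"
    assume sol: "is_solution M f K \<sigma> \<xi> \<tau> z"
      and init: "AE \<omega> in M. z (the_enat (\<tau> \<omega>)) \<omega> \<in> {K - \<delta><..<K + \<delta>}"
    have "AE \<omega> in M. (\<forall>n. \<tau> \<omega> \<le> enat n \<longrightarrow> (\<forall>k\<le>n. \<tau> \<omega> \<le> enat k \<longrightarrow> 0 \<le> z k \<omega>) \<longrightarrow>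
        z (Suc n) \<omega> = f (z n \<omega>) + \<sigma> * \<xi> (Suc n) \<omega> * (z n \<omega> - K)) \<and>
        z (the_enat (\<tau> \<omega>)) \<omega> \<in> {K - \<delta><..<K + \<delta>}"
      using sol init unfolding is_solution_def by auto
    then obtain N where N: "N \<in> null_sets M" "\<And>\<omega>. \<omega> \<in> space M - N \<Longrightarrow>
        (\<forall>n. \<tau> \<omega> \<le> enat n \<longrightarrow> (\<forall>k\<le>n. \<tau> \<omega> \<le> enat k \<longrightarrow> 0 \<le> z k \<omega>) \<longrightarrow>
        z (Suc n) \<omega> = f (z n \<omega>) + \<sigma> * \<xi> (Suc n) \<omega> * (z n \<omega> - K)) \<and>
        z (the_enat (\<tau> \<omega>)) \<omega> \<in> {K - \<delta><..<K + \<delta>}"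
      by (elim AE_E3) blast
    \<comment> \<open>Only the null set \<open>N\<close> depends on \<open>z\<close>; removing it
      makes the recursion and the initial condition hold pointwise without loss of
      probability.\<close>
    define H where "H = G - N"
    have H_meas: "H \<in> events" using G_meas N(1) by (auto simp: H_def)
    have H_prob: "prob H > 1 - \<gamma>"
      using n0(2) measure_Diff_null_set[OF G_meas N(1)] by (simp add: H_def G_def)
    have decay: "\<exists>k\<le>n0. \<tau> \<omega> = enat k \<and>
        (\<forall>j\<ge>k. \<bar>z j \<omega> - K\<bar> \<le> r * exp (- (m / 2) * (real j - real k)))" if H: "\<omega> \<in> H" for \<omega>
    proof -
      obtain k where k: "k \<le> n0" "\<tau> \<omega> = enat k" "\<omega> \<in> A k" and sp: "\<omega> \<in> space M - N"
        using H by (auto simp: H_def G_def)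
      have rec: "z (Suc n) \<omega> = f (z n \<omega>) + \<sigma> * \<xi> (Suc n) \<omega> * (z n \<omega> - K)"
        if "k \<le> n" "\<And>j. k \<le> j \<Longrightarrow> j \<le> n \<Longrightarrow> 0 \<le> z j \<omega>" for n
        using N(2)[OF sp] that k(2) by auto
      have bound: "\<bar>z (k + n) \<omega> - K\<bar> \<le> \<delta> * exp R * exp (- (m / 2) * real n)" for n
      proof (rule decay_from_log_sums[where y = "\<lambda>i. X \<epsilon> (\<xi> i \<omega>)" and r = r])
        show "\<bar>z k \<omega> - K\<bar> < \<delta>" using N(2)[OF sp] k(2) by auto
      next
        fix n assume kn: "k \<le> n" and "\<And>j. k \<le> j \<Longrightarrow> j \<le> n \<Longrightarrow> \<bar>z j \<omega> - K\<bar> < r"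
        then have small: "\<bar>z j \<omega> - K\<bar> < u" "\<bar>z j \<omega> - K\<bar> < K"
            "\<bar>z j \<omega> - K\<bar> < (\<epsilon> / C) powr (1 / \<kappa>)" if "k \<le> j" "j \<le> n" for j
          using that by (auto simp: r_def)
        \<comment> \<open>This discharges the domain condition in \<open>is_solution\<close>, so the
          recursion is available for the next step.\<close>
        have nonneg: "0 \<le> z j \<omega>" if "k \<le> j" "j \<le> n" for j using small(2)[OF that] by linarith
        let ?v = "z n \<omega> - K"
        have v: "\<bar>?v\<bar> < u" using small(1)[OF kn] by simp
        have "z (Suc n) \<omega> = f (z n \<omega>) + \<sigma> * \<xi> (Suc n) \<omega> * ?v"
          using rec[OF kn nonneg] .
        also have "f (z n \<omega>) = K - a * ?v + \<phi> ?v"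
          unfolding a_def using v by (intro f_expand nonneg kn) auto
        finally have "z (Suc n) \<omega> - K = - (a - \<sigma> * \<xi> (Suc n) \<omega>) * ?v + \<phi> ?v"
          by (simp add: algebra_simps)
        also have "\<bar>\<dots>\<bar> \<le> \<bar>?v\<bar> * (\<bar>a - \<sigma> * \<xi> (Suc n) \<omega>\<bar> + \<epsilon>)"
          using small(3)[OF kn] v
          by (intro perturbed_step_bound[OF phi_bound _ pos(3,4) eps]) auto
        also have "\<bar>a - \<sigma> * \<xi> (Suc n) \<omega>\<bar> + \<epsilon> = exp (X \<epsilon> (\<xi> (Suc n) \<omega>))"
          using eps by (simp add: X_def add_nonneg_pos)
        finally show "\<bar>z (Suc n) \<omega> - K\<bar> \<le> \<bar>?v\<bar> * exp (X \<epsilon> (\<xi> (Suc n) \<omega>))" .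
      qed (use k(3) m \<delta>R in \<open>auto simp: A_def\<close>)
      have "\<bar>z j \<omega> - K\<bar> \<le> r * exp (- (m / 2) * (real j - real k))" if "j \<ge> k" for j
        using bound[of "j - k"] that by (simp add: \<delta>R of_nat_diff)
      with k show ?thesis by blast
    qed
    have lim: "(\<lambda>j. z j \<omega>) \<longlonglongrightarrow> K" if H: "\<omega> \<in> H" for \<omega>
    proof -
      obtain k where k: "\<And>j. j \<ge> k \<Longrightarrow> \<bar>z j \<omega> - K\<bar> \<le> r * exp (- (m / 2) * (real j - real k))"
        using decay[OF H] by blast
      have "(\<lambda>j. r * exp (- (m / 2) * (real j - real k))) \<longlonglongrightarrow> 0"
        using m by real_asymp
      then have "(\<lambda>j. z j \<omega> - K) \<longlonglongrightarrow> 0"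
        by (rule Lim_null_comparison[rotated])
          (use k in \<open>auto intro: eventually_sequentiallyI[of k]\<close>)
      then show ?thesis by (simp add: LIM_zero_iff)
    qed
    \<comment> \<open>Since \<open>k \<le> n0\<close>, replacing the start \<open>k\<close> by
      \<open>n0\<close> only weakens the exponential bound.\<close>
    have late: "\<bar>z j \<omega> - K\<bar> \<le> r * exp (- (m / 2) * (real j - real n0))"
      if H: "\<omega> \<in> H" and j: "j \<ge> n0" for \<omega> j
    proof -
      obtain k where k: "k \<le> n0"
          "\<And>j. j \<ge> k \<Longrightarrow> \<bar>z j \<omega> - K\<bar> \<le> r * exp (- (m / 2) * (real j - real k))"
        using decay[OF H] by blast
      have "- (m / 2) * (real j - real k) \<le> - (m / 2) * (real j - real n0)"
        using k(1) m by (intro mult_left_mono_neg) auto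
      then have "r * exp (- (m / 2) * (real j - real k)) \<le> r * exp (- (m / 2) * (real j - real n0))"
        using r by (intro mult_left_mono) simp_all
      then show ?thesis using k(2)[of j] k(1) j by simp
    qed
    show "\<exists>\<Omega>\<^sub>\<gamma> \<in> sets M. measure M \<Omega>\<^sub>\<gamma> > 1 - \<gamma> \<and>
          (\<forall>\<omega>\<in>\<Omega>\<^sub>\<gamma>.
             (\<forall>j. \<tau> \<omega> \<le> enat j \<longrightarrow>
                \<bar>z j \<omega> - K\<bar> \<le> r * exp (- (m / 2) * (real j - real (the_enat (\<tau> \<omega>))))) \<and>
             (\<lambda>j. z j \<omega>) \<longlonglongrightarrow> K)"
    proof (intro bexI[OF _ H_meas] conjI H_prob ballI allI impI lim)
      fix \<omega> j assume "\<omega> \<in> H" "\<tau> \<omega> \<le> enat j"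
      with decay[OF this(1)]
      show "\<bar>z j \<omega> - K\<bar> \<le> r * exp (- (m / 2) * (real j - real (the_enat (\<tau> \<omega>))))" by auto
    qed
    show "\<exists>\<Omega>1 \<in> sets M. measure M \<Omega>1 > 1 - \<gamma> \<and>
          (\<exists>n0::nat. n0 \<ge> 1 \<and>
             (\<forall>\<omega>\<in>\<Omega>1. \<forall>j\<ge>n0.
                \<bar>z j \<omega> - K\<bar> \<le> r * exp (- (m / 2) * (real j - real n0))))"
      using H_meas H_prob n0(1) late by blast
  qed (use m r \<delta> in auto)
qed

end
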